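(* Let $x,y,z,m,n$ be positive integers with $x>y\geq 1$ and $m>n\geq 1$. (1) The solutions of $$\varphi\left(z\frac{x^{m}+y^{m}}{x+y}\right)=z\frac{x^{n}+y^{n}}{x+y},\qquad m,n \text{ both odd},$$ are exactly $(x,y,z,m,n)=(2,1,3^{s}2^{\beta},3,1)$ with integers $\beta\ge 1$, $s\ge 0$. (2) The solutions of $$\varphi\left(z\frac{x^{m}-y^{m}}{x+y}\right)=z\frac{x^{n}+y^{n}}{x+y},\qquad m \text{ even},\ n \text{ odd},$$ are exactly $(x,y,z,m,n)=(a+1,a,1,2,1)$, $(a+2,a,2^{s},2,1)$ and $(a+3,a,2^{\beta}3^{s},2,1)$ with integers $a\ge 1$, $\beta\geq 1$, $s\geq 0$. (3) The solutions of $$\varphi\left(z\frac{x^{m}+y^{m}}{x+y}\right)=z\frac{x^{n}-y^{n}}{x+y},\qquad m \text{ odd},\ n \text{ even},$$ with $\nu_{2}(x)\neq \nu_{2}(y)$ are exactly $(x,y,z,m,n)=(2,1,p^{s}2^{\beta},q,q-1)$, where $\beta\ge 1$, $s\ge 0$ are integers and $q$ and $p=\frac{2^{q}+1}{3}$ are both primes.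
   Context: $\varphi$ is Euler's totient function; $\nu_2(k)$ is the exponent of $2$ in $k$. *)

theory Defs
  imports "HOL-Number_Theory.Number_Theory"
begin

text \<open>The quotients below are taken with \<open>div\<close> on natural numbers; the following two facts
  show that these divisions are exact for the parities in question.\<close>

lemma sum_dvd_sum_powers_odd:
  fixes x y m :: nat
  assumes "odd m"
  shows "x + y dvd x ^ m + y ^ m"
proof -
  have "int x - (- int y) dvd int x ^ m - (- int y) ^ m"
    by (metis dvd_triv_left power_diff_sumr2)
  hence "int (x + y) dvd int (x ^ m + y ^ m)"
    using assms by simp
  thus ?thesis
    using of_nat_dvd_iff by blast
qed

lemma sum_dvd_diff_powers_even:
  fixes x y m :: nat
  assumes "even m" "y \<le> x"
  shows "x + y dvd x ^ m - y ^ m"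
proof -
  have "int x - (- int y) dvd int x ^ m - (- int y) ^ m"
    by (metis dvd_triv_left power_diff_sumr2)
  hence "int (x + y) dvd int (x ^ m - y ^ m)"
    using assms by (simp add: of_nat_diff power_mono)
  thus ?thesis
    using of_nat_dvd_iff by blast
qed

end

theory Submission
  imports Defs
begin

text \<open>Writing \<open>N\<close> for the argument of \<open>totient\<close> and cancelling the power of \<open>gcd x y\<close>, each equation
  becomes \<open>totient N * c = N * v\<close> with \<open>v\<close> odd. Every odd prime factor of \<open>N\<close> contributes
  a factor 2 to \<open>totient N\<close>, so \<open>N\<close> is 1, \<open>2 ^ k\<close> or \<open>2 ^ k * p ^ l\<close> with \<open>p\<close> congruent to 3 modulo 4; in
  particular \<open>c / v \<le> 3\<close>. In parts (1) and (3) this bound leaves only \<open>x = 2\<close>, \<open>y = 1\<close>.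
  In part (2) with \<open>m = 2 * r > 2\<close> and \<open>x = d * a\<close>, \<open>y = d * b\<close>, the factor \<open>F\<close> of \<open>a ^ m - b ^ m\<close>
  among \<open>a ^ r - b ^ r\<close> (for odd \<open>r\<close>) and \<open>a ^ r + b ^ r\<close> (for even \<open>r\<close>) is coprime to \<open>v\<close> and hence
  equal to \<open>p\<close>. For even \<open>r\<close> this contradicts \<open>p\<close> being 3 modulo 4; for odd \<open>r\<close> it makes
  \<open>a ^ r + b ^ r\<close> divide \<open>a ^ n + b ^ n\<close>, which forces \<open>n = r\<close> and then \<open>p = 3\<close>, too small.\<close>

section \<open>Totient ratios with an odd numerator\<close>

text \<open>Everything comes from counting factors of 2. As \<open>v\<close> is odd,
  \<open>totient N * c\<close> has exactly as many as \<open>N\<close>, and passing from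
  \<open>2 ^ k\<close> to its totient frees at most one. Every odd prime factor \<open>p\<close> of
  \<open>N\<close> gives at least one back through \<open>p - 1\<close>, so there is at most one
  such prime, and it requires \<open>k \<ge> 1\<close>.\<close>

lemma totient_ratio_odd_numerator:
  fixes N c v :: nat
  assumes N: "N > 0" and eq: "totient N * c = N * v" and v: "odd v"
  obtains (one) "N = 1" "c = v"
  | (two_power) k where "k \<ge> 1" "N = 2 ^ k" "c = 2 * v"
  | (two_prime_powers) k l p t where "k \<ge> 1" "l \<ge> 1" "prime p" "p = 2 * t + 1" "odd t"
      "N = 2 ^ k * p ^ l" "t * c = p * v"
proof -
  obtain k M where NM: "N = 2 ^ k * M" "odd M"
    using N multiplicity_decompose'[of N 2] by (metis nat_neq_iff not_prime_unit two_is_prime_nat)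
  have tN: "totient N = totient (2 ^ k) * totient M"
    using NM by (simp add: totient_mult_coprime)
  show ?thesis
  proof (cases "M = 1")
    case True
    show ?thesis
    proof (cases "k = 0")
      case True
      then show ?thesis using \<open>M = 1\<close> NM eq one by simp
    next
      case False
      then obtain j where j: "k = Suc j" by (cases k) auto
      have "totient N = 2 ^ j"
        using tN \<open>M = 1\<close> j totient_prime_power_Suc[OF two_is_prime_nat, of j] by simp
      then have "2 ^ j * c = 2 ^ j * (2 * v)"
        using eq NM \<open>M = 1\<close> j by simp
      then have "c = 2 * v" by simp
      then show ?thesis using two_power[of k] False NM \<open>M = 1\<close> by simp
    qed
  next
    case False
    then obtain p where p: "prime p" "p dvd M" using prime_factor_nat by blast
    have "M > 0" using NM N by auto
    obtain l L where L: "M = p ^ l * L" "\<not> p dvd L"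
      using \<open>M > 0\<close> multiplicity_decompose'[of M p] p
      by (metis nat_neq_iff not_prime_unit)
    have "l \<noteq> 0" using L p by (cases l) auto
    then obtain i where i: "l = Suc i" by (cases l) auto
    have "odd p" using p NM by (metis dvd_trans)
    have "odd L" using L NM by simp
    obtain t where t: "p = 2 * t + 1" using \<open>odd p\<close> by (elim oddE)
    have "coprime (p ^ l) L" using L p prime_imp_coprime by (simp add: prime_imp_coprime)
    then have tM: "totient M = p ^ i * (2 * t) * totient L"
      using L i totient_prime_power_Suc[OF p(1), of i] t
      by (simp add: totient_mult_coprime)
    have "k \<noteq> 0"
    proof
      assume "k = 0"
      then have "even (N * v)" using eq[symmetric] tN tM by simp
      then show False using NM v \<open>k = 0\<close> by simp
    qed
    then obtain j where j: "k = Suc j" by (cases k) auto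
    have t2: "totient (2 ^ k) = 2 ^ j"
      using j totient_prime_power_Suc[OF two_is_prime_nat, of j] by simp
    have "2 ^ k * (p ^ i * t * totient L * c) = 2 ^ k * (p ^ i * (p * L * v))"
      using eq tN t2 tM NM L j i by (simp add: algebra_simps)
    \<comment> \<open>The single 2 freed by \<open>totient (2 ^ k)\<close> is spent on
      \<open>p - 1 = 2 * t\<close>. The right side is now odd, so no factor on the left can be even,
      and an odd totient leaves no room for a further odd prime in \<open>L\<close>.\<close>
    then have red: "t * totient L * c = p * L * v"
      using p by (simp add: prime_gt_0_nat mult.assoc)
    then have odds: "odd t" "odd (totient L)"
      using \<open>odd p\<close> \<open>odd L\<close> v by (metis even_mult_iff)+
    have "L = 1"
    proof (rule ccontr)
      assume "L \<noteq> 1"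
      then have "L > 2" using \<open>odd L\<close> by (cases L; cases "L = 2") auto
      then show False using odds totient_even by blast
    qed
    then show ?thesis
      using two_prime_powers[of k l p t] p t odds red NM L \<open>k \<noteq> 0\<close> \<open>l \<noteq> 0\<close> by simp
  qed
qed

section \<open>Quotients by the sum of the bases\<close>

text \<open>If one base is even, coprimality makes the other odd and the numerator itself is odd. If
  both are odd, the numerator is even and the parity is read off from a recursion for the
  quotient.\<close>

lemma odd_sum_powers_quotient:
  fixes a b n :: nat
  assumes "odd n" "coprime a b"
  shows "odd ((a ^ n + b ^ n) div (a + b))"
proof (cases "even a \<or> even b")
  case True
  have "\<not> (even a \<and> even b)" using assms by (meson coprime_common_divisor odd_one)
  then have "odd (a ^ n + b ^ n)" using True assms odd_pos by auto
  then show ?thesis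
    using sum_dvd_sum_powers_odd[OF assms(1), of a b] by (metis dvd_div_mult_self even_mult_iff)
next
  case False
  have "\<exists>w::int. odd w \<and> int a ^ (2 * j + 1) + int b ^ (2 * j + 1) = (int a + int b) * w" for j
  proof (induction j)
    case 0
    show ?case by (intro exI[of _ 1]) simp
  next
    case (Suc j)
    then obtain w where w: "odd w" "int a ^ (2 * j + 1) + int b ^ (2 * j + 1) = (int a + int b) * w"
      by blast
    \<comment> \<open>Multiplying the relation by \<open>a ^ 2\<close> and subtracting
      \<open>b ^ (2 * j + 1) * (a ^ 2 - b ^ 2)\<close> raises both exponents by 2. The subtracted
      term contributes the even factor \<open>a - b\<close> to the quotient, so \<open>w'\<close>
      stays odd.\<close>
    define w' where "w' = int a ^ 2 * w - int b ^ (2 * j + 1) * (int a - int b)"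
    have "odd w'" using w False by (simp add: w'_def)
    moreover have "(int a + int b) * w' = int a ^ 2 * (int a ^ (2 * j + 1) + int b ^ (2 * j + 1))
        - int b ^ (2 * j + 1) * (int a ^ 2 - int b ^ 2)"
      unfolding w(2) w'_def by (simp add: algebra_simps power2_eq_square)
    then have "int a ^ (2 * Suc j + 1) + int b ^ (2 * Suc j + 1) = (int a + int b) * w'"
      by (simp add: algebra_simps power2_eq_square)
    ultimately show ?case by blast
  qed
  moreover obtain j where "n = 2 * j + 1" using assms(1) by (elim oddE)
  ultimately obtain w where w: "odd w" "int a ^ n + int b ^ n = (int a + int b) * w" by blast
  define q where "q = (a ^ n + b ^ n) div (a + b)"
  have "a ^ n + b ^ n = (a + b) * q"
    using sum_dvd_sum_powers_odd[OF assms(1), of a b] by (simp add: q_def)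
  then have "int a ^ n + int b ^ n = (int a + int b) * int q"
    by (metis of_nat_add of_nat_mult of_nat_power)
  moreover have "int a + int b \<noteq> 0" using False by (auto elim: oddE)
  ultimately have "w = int q" using w(2) by simp
  then show ?thesis using w(1) by (simp add: q_def)
qed

lemma homogeneous_sum_quotient:
  fixes d a b n :: nat
  assumes "n \<ge> 1" "d > 0" "odd n"
  shows "((d * a) ^ n + (d * b) ^ n) div (d * a + d * b) = d ^ (n - 1) * ((a ^ n + b ^ n) div (a + b))"
proof -
  have "(d * a) ^ n + (d * b) ^ n = d * (d ^ (n - 1) * (a ^ n + b ^ n))"
    using assms by (cases n) (simp_all add: power_mult_distrib algebra_simps)
  moreover have "d * a + d * b = d * (a + b)" by (simp add: algebra_simps)
  ultimately show ?thesis
    using assms by (simp add: sum_dvd_sum_powers_odd div_mult_swap)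
qed

lemma homogeneous_diff_quotient:
  fixes d a b n :: nat
  assumes "n \<ge> 1" "d > 0" "even n" "b \<le> a"
  shows "((d * a) ^ n - (d * b) ^ n) div (d * a + d * b) = d ^ (n - 1) * ((a ^ n - b ^ n) div (a + b))"
proof -
  have "(d * a) ^ n - (d * b) ^ n = d * (d ^ (n - 1) * (a ^ n - b ^ n))"
    using assms by (cases n) (simp_all add: power_mult_distrib algebra_simps diff_mult_distrib2)
  moreover have "d * a + d * b = d * (a + b)" by (simp add: algebra_simps)
  ultimately show ?thesis
    using assms by (simp add: sum_dvd_diff_powers_even div_mult_swap)
qed

section \<open>The equation \<open>totient (z * U) = z * V\<close>\<close>

text \<open>\<open>V\<close> itself may be even: in the applications \<open>e\<close> is a power of
  the gcd of the bases. Cancelling \<open>e\<close> exposes the odd numerator \<open>v\<close> that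
  the counting of factors of 2 needs.\<close>

lemma totient_equation_cases:
  fixes z U V e c v :: nat
  assumes eq: "totient (z * U) = z * V" and pos: "z > 0" "U > 0"
    and U: "U = e * c" and V: "V = e * v" and v: "odd v"
  obtains (equal) "U = V"
  | (two_power) "U = 2 * V"
  | (two_prime_powers) k l p t where "k \<ge> 1" "l \<ge> 1" "prime p" "p = 2 * t + 1" "odd t"
      "z * U = 2 ^ k * p ^ l" "t * U = p * V"
proof -
  have "e > 0" using U pos by (cases e) auto
  have "e * (totient (z * U) * c) = e * (z * U * v)" using eq U V by simp
  then have ratio: "totient (z * U) * c = z * U * v" using \<open>e > 0\<close> by simp
  have "z * U > 0" using pos by simp
  from this ratio v show ?thesis
  proof (cases rule: totient_ratio_odd_numerator)
    case one
    then show ?thesis using equal U V by simp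
  next
    case (two_power k)
    then show ?thesis using that(2) U V by simp
  next
    case (two_prime_powers k l p t)
    have "t * U = p * V" using two_prime_powers(7) U V by (metis mult.left_commute)
    then show ?thesis using that(3) two_prime_powers by blast
  qed
qed

text \<open>The possible ratios \<open>U / V\<close> are 1, 2 and
  \<open>p / t = 2 + 1 / t\<close>.\<close>

lemma totient_equation_bound:
  fixes z U V e c v :: nat
  assumes "totient (z * U) = z * V" "z > 0" "U > 0" "U = e * c" "V = e * v" "odd v"
  shows "U \<le> 3 * V"
  using assms
proof (cases rule: totient_equation_cases)
  case (two_prime_powers k l p t)
  have "t \<ge> 1" using \<open>odd t\<close> by (cases t) auto
  have "t * U = 2 * (t * V) + 1 * V" using two_prime_powers by (simp add: algebra_simps)
  also have "\<dots> \<le> 2 * (t * V) + t * V" using \<open>t \<ge> 1\<close> by (intro add_mono mult_mono) auto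
  finally have "t * U \<le> t * (3 * V)" by simp
  then show ?thesis using \<open>t \<ge> 1\<close> by simp
qed auto

lemma coprime_scaling:
  fixes x y :: nat
  assumes "x > y" "y \<ge> 1"
  obtains d a b where "d > 0" "coprime a b" "a > b" "b \<ge> 1" "x = d * a" "y = d * b"
proof -
  define d where "d = gcd x y"
  have d: "d > 0" using assms by (simp add: d_def)
  obtain a b where ab: "x = a * d" "y = b * d" "coprime a b"
    using gcd_coprime_exists[of x y] d unfolding d_def by auto
  show ?thesis
    using that[of d a b] d ab assms by (simp add: mult.commute)
qed

text \<open>The 2 lost in \<open>totient (2 ^ \<beta>)\<close> is restored by
  \<open>p - 1 = 2 * t\<close>. This serves to verify the listed solutions.\<close>

lemma totient_two_prime_powers:
  fixes p t \<beta> s :: nat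
  assumes "prime p" "p = 2 * t + 1" "\<beta> \<ge> 1"
  shows "totient (p ^ s * 2 ^ \<beta> * p) = p ^ s * 2 ^ \<beta> * t"
proof -
  obtain j where j: "\<beta> = Suc j" using assms(3) by (cases \<beta>) auto
  have "coprime (2 ^ Suc j) (p ^ Suc s)" using assms(2) by simp
  then have "totient (2 ^ Suc j * p ^ Suc s) = totient (2 ^ Suc j) * totient (p ^ Suc s)"
    by (rule totient_mult_coprime)
  also have "\<dots> = 2 ^ j * (p ^ s * (2 * t))"
    using totient_prime_power_Suc[OF assms(1), of s] totient_prime_power_Suc[OF two_is_prime_nat, of j]
      assms(2) by simp
  finally show ?thesis by (simp add: j ac_simps)
qed

lemma totient_three_two_powers:
  fixes \<beta> s :: nat
  assumes "\<beta> \<ge> 1"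
  shows "totient (3 ^ s * 2 ^ \<beta> * 3) = 3 ^ s * 2 ^ \<beta>"
proof -
  have "prime (3::nat)" and "(3::nat) = 2 * 1 + 1" by simp_all
  then have "totient (3 ^ s * 2 ^ \<beta> * 3) = 3 ^ s * 2 ^ \<beta> * 1"
    using assms by (rule totient_two_prime_powers)
  then show ?thesis by (simp only: mult_1_right)
qed

section \<open>Both exponents odd\<close>

lemma odd_odd_solution:
  fixes x y z m n :: nat
  assumes xy: "x > y" "y \<ge> 1" and z: "z \<ge> 1" and mn: "m > n" "n \<ge> 1" "odd m" "odd n"
    and eq: "totient (z * ((x ^ m + y ^ m) div (x + y))) = z * ((x ^ n + y ^ n) div (x + y))"
  shows "x = 2 \<and> y = 1 \<and> m = 3 \<and> n = 1 \<and> (\<exists>s \<beta>. \<beta> \<ge> 1 \<and> z = 3 ^ s * 2 ^ \<beta>)"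
proof -
  define U where "U = (x ^ m + y ^ m) div (x + y)"
  define V where "V = (x ^ n + y ^ n) div (x + y)"
  have U: "(x + y) * U = x ^ m + y ^ m" and V: "(x + y) * V = x ^ n + y ^ n"
    unfolding U_def V_def using mn by (simp_all add: sum_dvd_sum_powers_odd)
  obtain d a b where ab: "d > 0" "coprime a b" "a > b" "b \<ge> 1" "x = d * a" "y = d * b"
    using coprime_scaling xy by blast
  define v where "v = (a ^ n + b ^ n) div (a + b)"
  \<comment> \<open>The surplus \<open>d ^ (m - n)\<close> goes into \<open>c\<close>, so that
    \<open>d ^ (n - 1)\<close> is the common factor of \<open>U\<close> and
    \<open>V\<close>.\<close>
  define c where "c = d ^ (m - n) * ((a ^ m + b ^ m) div (a + b))"
  have Vv: "V = d ^ (n - 1) * v"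
    unfolding V_def v_def ab(5,6) using mn ab by (intro homogeneous_sum_quotient) auto
  have "U = d ^ (m - 1) * ((a ^ m + b ^ m) div (a + b))"
    unfolding U_def ab(5,6) using mn ab by (intro homogeneous_sum_quotient) auto
  moreover have "m - 1 = (n - 1) + (m - n)" using mn by simp
  ultimately have Uc: "U = d ^ (n - 1) * c" by (simp only: c_def power_add mult.assoc)
  have "U > 0" using U xy by (cases U) auto
  have "odd v" unfolding v_def using ab mn odd_sum_powers_quotient by blast
  have eq': "totient (z * U) = z * V" and "z > 0" using eq z by (simp_all add: U_def V_def)
  note tot = eq' \<open>z > 0\<close> \<open>U > 0\<close> Uc Vv \<open>odd v\<close>
  have "U \<le> 3 * V" using totient_equation_bound[OF tot] .
  then have "(x + y) * U \<le> 3 * ((x + y) * V)" by simp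
  then have size: "x ^ m + y ^ m \<le> 3 * (x ^ n + y ^ n)" using U V by simp
  \<comment> \<open>Two distinct odd exponents differ by at least 2, so \<open>x ^ m\<close> is at
    least \<open>4 * x ^ n\<close>, which competes with the factor 3 in \<open>size\<close>.\<close>
  obtain i where i: "m = n + 2 + i"
  proof -
    have "m - n \<noteq> 1" using mn by (metis add.commute even_plus_one_iff less_imp_le_nat le_add_diff_inverse2)
    then show ?thesis using that[of "m - n - 2"] mn by simp
  qed
  have xm: "x ^ m = x ^ n * (x ^ 2 * x ^ i)" and ym: "y ^ m = y ^ n * (y ^ 2 * y ^ i)"
    by (simp_all add: i power_add power2_eq_square)
  have "x \<ge> 2" using xy by simp
  have "4 \<le> x ^ 2" using power_mono[OF \<open>x \<ge> 2\<close>, of 2] by simp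
  have xi: "1 \<le> x ^ i" "1 \<le> y ^ i" using xy by auto
  have "4 * 1 \<le> x ^ 2 * x ^ i" using \<open>4 \<le> x ^ 2\<close> xi by (intro mult_mono) auto
  then have x4: "x ^ n * 4 \<le> x ^ m" unfolding xm by simp
  have "y = 1"
  proof (rule ccontr)
    assume "y \<noteq> 1"
    then have "y \<ge> 2" using xy by simp
    then have "4 \<le> y ^ 2" using power_mono[of 2 y 2] by simp
    then have "4 * 1 \<le> y ^ 2 * y ^ i" using xi by (intro mult_mono) auto
    then have "y ^ n * 4 \<le> y ^ m" unfolding ym by simp
    moreover have "x ^ n > 0" using xy by simp
    ultimately show False using size x4 unfolding distrib_left by linarith
  qed
  have xn: "x ^ n \<le> 2" using size x4 \<open>y = 1\<close> by simp
  have "x ^ 1 \<le> x ^ n" using mn xy by (intro power_increasing) auto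
  then have "x = 2" using xn \<open>x \<ge> 2\<close> by simp
  have "n = 1"
  proof (rule ccontr)
    assume "n \<noteq> 1"
    then have "x ^ 2 \<le> x ^ n" using mn xy by (intro power_increasing) auto
    then show False using xn \<open>4 \<le> x ^ 2\<close> by simp
  qed
  \<comment> \<open>Otherwise \<open>m \<ge> 4\<close>, and \<open>2 ^ 4 + 1 = 17\<close> already
    exceeds \<open>3 * (2 + 1) = 9\<close>.\<close>
  have "i = 0"
  proof (rule ccontr)
    assume "i \<noteq> 0"
    then have "(2::nat) ^ 4 \<le> 2 ^ m" using i \<open>n = 1\<close> by (intro power_increasing) auto
    then show False using size \<open>x = 2\<close> \<open>y = 1\<close> \<open>n = 1\<close> by simp
  qed
  then have "m = 3" using i \<open>n = 1\<close> by simp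
  have UV: "U = 3" "V = 1" using U V \<open>x = 2\<close> \<open>y = 1\<close> \<open>m = 3\<close> \<open>n = 1\<close> by auto
  then have "U \<noteq> V" "U \<noteq> 2 * V" by auto
  then obtain k l p t where klpt: "k \<ge> 1" "l \<ge> 1" "p = 2 * t + 1" "z * U = 2 ^ k * p ^ l" "t * U = p * V"
    using totient_equation_cases[OF tot] by metis
  \<comment> \<open>Here \<open>3 * t = p = 2 * t + 1\<close>, hence \<open>t = 1\<close>.\<close>
  then have "p = 3" using UV by simp
  moreover have "(3::nat) ^ l = 3 ^ (l - 1) * 3" using klpt(2) by (simp add: power_eq_if)
  ultimately have "z = 3 ^ (l - 1) * 2 ^ k" using klpt(4) UV by simp
  then show ?thesis using \<open>x = 2\<close> \<open>y = 1\<close> \<open>m = 3\<close> \<open>n = 1\<close> klpt(1) by blast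
qed

section \<open>Odd \<open>m\<close> and even \<open>n\<close>\<close>

text \<open>A divisor \<open>r\<close> of \<open>m\<close> with \<open>1 < r < m\<close> would make
  \<open>(2 ^ r + 1) / 3\<close> a nontrivial divisor of \<open>p\<close>: 3 divides
  \<open>2 ^ r + 1\<close> because \<open>r\<close> is odd, and \<open>2 ^ r + 1\<close> divides
  \<open>2 ^ m + 1\<close> because \<open>m / r\<close> is odd.\<close>

lemma prime_exponent_of_prime_Wagstaff:
  fixes p m :: nat
  assumes p: "prime p" and m: "odd m" and eq: "3 * p = 2 ^ m + 1"
  shows "prime m"
proof (rule ccontr)
  assume np: "\<not> prime m"
  have "m \<noteq> 1" using eq p by auto
  then have "m > 1" using m by (cases m) auto
  then obtain r where r: "r dvd m" "r \<noteq> 1" "r \<noteq> m"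
    using np by (auto simp: prime_nat_iff)
  then obtain k where k: "m = r * k" by blast
  then have odds: "odd r" "odd k" using m by auto
  have "r > 1" using r odds by (cases r) auto
  have "r < m" using r \<open>m > 1\<close> by (metis dvd_imp_le dual_order.strict_implies_order gr0I le_neq_implies_less not_one_less_zero)
  have "2 ^ r + (1::nat) dvd 2 ^ m + 1"
    using sum_dvd_sum_powers_odd[OF odds(2), of "2 ^ r" 1] by (simp add: k power_mult)
  moreover have "3 dvd 2 ^ r + (1::nat)"
    using sum_dvd_sum_powers_odd[OF odds(1), of 2 1] by (simp add: numeral_3_eq_3)
  then obtain f where f: "2 ^ r + (1::nat) = 3 * f" by blast
  ultimately have "f dvd p" using eq by (metis dvd_times_left_cancel_iff nat_mult_dvd_cancel_disj numeral_neq_zero zero_neq_numeral)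
  have "(2::nat) ^ 2 \<le> 2 ^ r" using \<open>r > 1\<close> by (intro power_increasing) auto
  then have "f \<noteq> 1" using f by auto
  moreover have "(2::nat) ^ r < 2 ^ m" using \<open>r < m\<close> by simp
  then have "f \<noteq> p" using f eq by auto
  ultimately show False using \<open>f dvd p\<close> p unfolding prime_nat_iff by blast
qed

lemma odd_even_solution:
  fixes x y z m n :: nat
  assumes xy: "x > y" "y \<ge> 1" and z: "z \<ge> 1" and mn: "m > n" "n \<ge> 1" "odd m" "even n"
    and mult: "multiplicity 2 x \<noteq> multiplicity 2 y"
    and eq: "totient (z * ((x ^ m + y ^ m) div (x + y))) = z * ((x ^ n - y ^ n) div (x + y))"
  shows "x = 2 \<and> y = 1 \<and> n = m - 1 \<and> prime m \<and>
    (\<exists>p s \<beta>. \<beta> \<ge> 1 \<and> prime p \<and> 3 * p = 2 ^ m + 1 \<and> z = p ^ s * 2 ^ \<beta>)"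
proof -
  define U where "U = (x ^ m + y ^ m) div (x + y)"
  define V where "V = (x ^ n - y ^ n) div (x + y)"
  have U: "(x + y) * U = x ^ m + y ^ m" and V: "(x + y) * V = x ^ n - y ^ n"
    unfolding U_def V_def using mn xy by (simp_all add: sum_dvd_sum_powers_odd sum_dvd_diff_powers_even)
  obtain d a b where ab: "d > 0" "coprime a b" "a > b" "b \<ge> 1" "x = d * a" "y = d * b"
    using coprime_scaling xy by blast
  define v where "v = (a ^ n - b ^ n) div (a + b)"
  define c where "c = d ^ (m - n) * ((a ^ m + b ^ m) div (a + b))"
  have Vv: "V = d ^ (n - 1) * v"
    unfolding V_def v_def ab(5,6) using mn ab by (intro homogeneous_diff_quotient) auto
  have "U = d ^ (m - 1) * ((a ^ m + b ^ m) div (a + b))"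
    unfolding U_def ab(5,6) using mn ab by (intro homogeneous_sum_quotient) auto
  moreover have "m - 1 = (n - 1) + (m - n)" using mn by simp
  ultimately have Uc: "U = d ^ (n - 1) * c" by (simp only: c_def power_add mult.assoc)
  have "U > 0" using U xy by (cases U) auto
  have "odd v"
  proof -
    \<comment> \<open>This is where the valuations enter: if both reduced bases were odd,
      \<open>x\<close> and \<open>y\<close> would share the 2-adic valuation of
      \<open>d\<close>.\<close>
    have "even a \<or> even b"
    proof (rule ccontr)
      assume "\<not> (even a \<or> even b)"
      then have "multiplicity 2 x = multiplicity 2 d" "multiplicity 2 y = multiplicity 2 d"
        using ab by (simp_all add: prime_elem_multiplicity_mult_distrib not_dvd_imp_multiplicity_0)
      then show False using mult by simp
    qed
    moreover have "\<not> (even a \<and> even b)" using ab by (meson coprime_common_divisor odd_one)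
    moreover have "\<not> a ^ n < b ^ n" using ab by (simp add: power_mono not_less)
    ultimately have "odd (a ^ n - b ^ n)" using mn by auto
    moreover have "a ^ n - b ^ n = (a + b) * v"
      unfolding v_def using mn ab by (simp add: sum_dvd_diff_powers_even)
    ultimately show ?thesis by simp
  qed
  have eq': "totient (z * U) = z * V" and "z > 0" using eq z by (simp_all add: U_def V_def)
  note tot = eq' \<open>z > 0\<close> \<open>U > 0\<close> Uc Vv \<open>odd v\<close>
  have "U \<le> 3 * V" using totient_equation_bound[OF tot] .
  then have "(x + y) * U \<le> 3 * ((x + y) * V)" by simp
  then have size: "x ^ m + y ^ m \<le> 3 * (x ^ n - y ^ n)" using U V by simp
  have "y ^ n > 0" using xy by simp
  have "x ^ m = x ^ n * x ^ (m - n)" using mn by (simp flip: power_add)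
  moreover have "x ^ n > 0" using xy by simp
  \<comment> \<open>The positive term \<open>y ^ n\<close> makes the bound strict;
    \<open>x ^ (m - n) < 3\<close> then leaves only \<open>x = 2\<close> and
    \<open>m = n + 1\<close>.\<close>
  then have "x ^ m < x ^ n * 3" using size \<open>y ^ n > 0\<close> by linarith
  ultimately have small: "x ^ (m - n) < 3" using xy by simp
  have "x ^ 1 \<le> x ^ (m - n)" using mn xy by (intro power_increasing) auto
  then have x: "x = 2" and y: "y = 1" using small xy by auto
  have n: "n = m - 1"
  proof (rule ccontr)
    assume "n \<noteq> m - 1"
    then have "x ^ 2 \<le> x ^ (m - n)" using mn xy by (intro power_increasing) auto
    then show False using small x by simp
  qed
  have "(2::nat) ^ m = 2 * 2 ^ n" using n mn by (simp add: power_eq_if)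
  moreover have "(2::nat) ^ n \<ge> 1" by simp
  moreover have U3: "3 * U = 2 ^ m + 1" and "3 * V = 2 ^ n - 1" using U V x y by auto
  ultimately have UV: "U = 2 * V + 1" by linarith
  have "U \<noteq> V" "U \<noteq> 2 * V" using UV by auto
  then obtain k l p t where klpt: "k \<ge> 1" "l \<ge> 1" "prime p" "p = 2 * t + 1"
      "z * U = 2 ^ k * p ^ l" "t * U = p * V"
    using totient_equation_cases[OF tot] by metis
  \<comment> \<open>\<open>t * (2 * V + 1) = (2 * t + 1) * V\<close> collapses to
    \<open>t = V\<close>, so \<open>U\<close> is the prime \<open>p\<close> itself.\<close>
  have "t = V" using klpt(4,6) UV by (simp add: algebra_simps)
  then have "p = U" using klpt UV by simp
  have "p ^ l = p ^ (l - 1) * p" using klpt(2) by (simp add: power_eq_if)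
  then have "z * p = p ^ (l - 1) * 2 ^ k * p" using klpt(5) \<open>p = U\<close>
    by (simp only: ac_simps)
  then have "z = p ^ (l - 1) * 2 ^ k" using prime_gt_0_nat[OF klpt(3)] by simp
  moreover have "prime m"
    using prime_exponent_of_prime_Wagstaff[OF klpt(3) mn(3)] U3 \<open>p = U\<close> by simp
  ultimately show ?thesis using x y n klpt \<open>p = U\<close> U3 by blast
qed

section \<open>Coprimality, size and residues for even \<open>m\<close>\<close>

text \<open>A common divisor of \<open>k\<close> and \<open>b\<close> divides \<open>a ^ j\<close>,
  which is coprime to \<open>b\<close>. So \<open>k\<close> is coprime to \<open>b\<close> and,
  being odd, to \<open>2 * b ^ i\<close>, which it divides.\<close>

lemma odd_common_divisor_is_unit:
  fixes a b k :: int
  assumes "k dvd 2 * b ^ i" "k dvd a ^ j + s * b ^ j" "j > 0" "coprime a b" "odd k"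
  shows "is_unit k"
proof -
  have "coprime k b"
  proof (rule coprimeI)
    fix q assume q: "q dvd k" "q dvd b"
    then have "q dvd a ^ j + s * b ^ j" "q dvd s * b ^ j"
      using assms by (auto intro: dvd_trans dvd_power)
    then have "q dvd a ^ j" using dvd_add_left_iff by blast
    moreover have "coprime (a ^ j) q"
      using assms q by (meson coprime_divisors coprime_power_left_iff dvd_refl)
    ultimately show "is_unit q" using coprime_common_divisor dvd_refl by blast
  qed
  then have "coprime k (b ^ i)" by simp
  moreover have "coprime k 2" using assms by simp
  ultimately show ?thesis using assms(1)
    by (metis coprime_commute coprime_dvd_mult_right_iff coprime_common_divisor dvd_refl)
qed

lemma diff_dvd_diff_powers: "x - y dvd x ^ n - y ^ n" for x y :: "'a::comm_ring_1"
  by (metis dvd_triv_left power_diff_sumr2)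

lemma diff_mult_sum_nat: "(x - y) * (x + y) = x * x - y * y" for x y :: nat
proof -
  have "(x - y) * (x + y) = x * (x + y) - y * (x + y)" by (rule diff_mult_distrib)
  also have "\<dots> = x * x - y * y" by (simp add: distrib_left mult.commute)
  finally show ?thesis .
qed

text \<open>Modulo a common divisor, \<open>a ^ r = b ^ r\<close> and
  \<open>a ^ n = - (b ^ n)\<close>. Raising these to the powers \<open>n\<close> and
  \<open>r\<close>, with \<open>r\<close> odd, gives \<open>a ^ (r * n)\<close> the values
  \<open>b ^ (r * n)\<close> and \<open>- (b ^ (r * n))\<close>, so the divisor divides
  \<open>2 * b ^ (r * n)\<close>.\<close>

lemma coprime_sum_diff_powers:
  fixes a b r n v :: nat
  assumes "coprime a b" "b \<le> a" "odd r" "odd n" "odd v" "v dvd a ^ n + b ^ n"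
  shows "coprime v (a ^ r - b ^ r)"
proof (rule coprimeI)
  fix k assume k: "k dvd v" "k dvd a ^ r - b ^ r"
  have "b ^ r \<le> a ^ r" using assms by (simp add: power_mono)
  then have k1: "int k dvd int a ^ r - int b ^ r" using k by (metis of_nat_diff of_nat_dvd_iff of_nat_power)
  have "k dvd a ^ n + b ^ n" using k assms dvd_trans by blast
  then have k2: "int k dvd int a ^ n + int b ^ n" by (metis of_nat_add of_nat_dvd_iff of_nat_power)
  have "int k dvd (int a ^ r) ^ n - (int b ^ r) ^ n"
    using dvd_trans[OF k1 diff_dvd_diff_powers] .
  moreover have "int k dvd (int a ^ n) ^ r - (- (int b ^ n)) ^ r"
    using k2 diff_dvd_diff_powers[of "int a ^ n" "- (int b ^ n)" r] by (auto intro: dvd_trans)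
  then have "int k dvd (int a ^ r) ^ n + (int b ^ r) ^ n"
    using assms by (simp flip: power_mult add: mult.commute)
  ultimately have "int k dvd ((int a ^ r) ^ n + (int b ^ r) ^ n) - ((int a ^ r) ^ n - (int b ^ r) ^ n)"
    using dvd_diff by blast
  then have "int k dvd 2 * int b ^ (r * n)" by (simp add: power_mult)
  moreover have "odd (int k)" using k assms by (metis dvd_trans even_of_nat)
  ultimately show "is_unit k"
    using odd_common_divisor_is_unit[of "int k" "int b" "r * n" "int a" n 1] k2 assms
    by (simp add: odd_pos)
qed

text \<open>The same clash of signs for \<open>a ^ (r * n)\<close>: the odd power \<open>n\<close>
  keeps the minus sign of \<open>a ^ r = - (b ^ r)\<close>, the even power \<open>r\<close> removes
  that of \<open>a ^ n = - (b ^ n)\<close>.\<close>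

lemma coprime_sum_powers_odd_even:
  fixes a b r n v :: nat
  assumes "coprime a b" "even r" "odd n" "odd v" "v dvd a ^ n + b ^ n"
  shows "coprime v (a ^ r + b ^ r)"
proof (rule coprimeI)
  fix k assume k: "k dvd v" "k dvd a ^ r + b ^ r"
  have k1: "int k dvd int a ^ r + int b ^ r" using k by (metis of_nat_add of_nat_dvd_iff of_nat_power)
  have "k dvd a ^ n + b ^ n" using k assms dvd_trans by blast
  then have k2: "int k dvd int a ^ n + int b ^ n" by (metis of_nat_add of_nat_dvd_iff of_nat_power)
  have "int k dvd (int a ^ r) ^ n - (- (int b ^ r)) ^ n"
    using k1 diff_dvd_diff_powers[of "int a ^ r" "- (int b ^ r)" n] by (auto intro: dvd_trans)
  moreover have "int k dvd (int a ^ n) ^ r - (- (int b ^ n)) ^ r"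
    using k2 diff_dvd_diff_powers[of "int a ^ n" "- (int b ^ n)" r] by (auto intro: dvd_trans)
  then have "int k dvd (int a ^ r) ^ n - (int b ^ r) ^ n"
    using assms by (simp flip: power_mult add: mult.commute)
  ultimately have "int k dvd ((int a ^ r) ^ n + (int b ^ r) ^ n) - ((int a ^ r) ^ n - (int b ^ r) ^ n)"
    using assms dvd_diff by (metis diff_minus_eq_add power_minus_odd)
  then have "int k dvd 2 * int b ^ (r * n)" by (simp add: power_mult)
  moreover have "odd (int k)" using k assms by (metis dvd_trans even_of_nat)
  ultimately show "is_unit k"
    using odd_common_divisor_is_unit[of "int k" "int b" "r * n" "int a" n 1] k2 assms
    by (simp add: odd_pos)
qed

text \<open>It is enough to beat the exponent \<open>m - 1\<close>: since
  \<open>a \<ge> b + 1\<close>, \<open>a ^ m\<close> is at least \<open>A + b * A\<close>, and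
  \<open>b * A\<close> exceeds \<open>b ^ (m - 1) + b ^ m\<close>. For \<open>m = 2\<close>,
  \<open>n = 1\<close>, \<open>a = b + 1\<close> there is equality.\<close>

lemma sum_powers_less_diff_powers:
  fixes a b m n :: nat
  assumes "a > b" "b \<ge> 1" "m > n" "m \<ge> 3"
  shows "a ^ n + b ^ n < a ^ m - b ^ m"
proof -
  obtain i where i: "m = Suc (Suc (Suc i))"
    using assms(4) by (metis Suc_le_D numeral_3_eq_3 Suc_le_mono)
  define A where "A = a ^ Suc (Suc i)"
  define B where "B = b ^ Suc i"
  have An: "a ^ n \<le> A" and Bn: "b ^ n \<le> b * B"
    using assms i power_increasing[of n "Suc (Suc i)" a] power_increasing[of n "Suc (Suc i)" b]
    by (auto simp: A_def B_def)
  have "b * (Suc b * B) \<le> b * (a * B)"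
    using assms by (intro mult_mono) auto
  also have "\<dots> < b * A"
    using assms power_strict_mono[of b a "Suc i"] by (simp add: A_def B_def)
  finally have "b * B + b * (b * B) < b * A" by (simp add: algebra_simps)
  moreover have "A + b * A \<le> a * A"
    using mult_right_mono[of "Suc b" a A] assms by simp
  moreover have "a ^ m = a * A" "b ^ m = b * (b * B)" by (simp_all add: i A_def B_def)
  ultimately show ?thesis using An Bn by linarith
qed

text \<open>Size gives \<open>n = r + j\<close> with \<open>j < r\<close>. Reducing
  \<open>a ^ n + b ^ n\<close> modulo \<open>a ^ r + b ^ r\<close> leaves
  \<open>b ^ r * (a ^ j - b ^ j)\<close> up to sign; the first factor is coprime to the modulus and
  the second is smaller than it, hence zero.\<close>

lemma sum_powers_dvd_imp_exponent_eq:
  fixes a b r n :: nat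
  assumes "coprime a b" "a > b" "b \<ge> 1" "n < 2 * r" "a ^ r + b ^ r dvd a ^ n + b ^ n"
  shows "n = r"
proof -
  have "r \<le> n"
  proof (rule ccontr)
    assume "\<not> r \<le> n"
    then have "a ^ n < a ^ r" "b ^ n \<le> b ^ r"
      using assms by (auto intro: power_increasing)
    moreover have "a ^ r + b ^ r \<le> a ^ n + b ^ n"
      using assms by (intro dvd_imp_le) auto
    ultimately show False by simp
  qed
  then obtain j where j: "n = r + j" "j < r" using assms(4) by (metis add_less_cancel_left le_Suc_ex mult_2)
  have le: "b ^ j \<le> a ^ j" using assms by (simp add: power_mono)
  then have "b ^ r * b ^ j \<le> b ^ r * a ^ j" by simp
  then have "(a ^ n + b ^ n) + b ^ r * (a ^ j - b ^ j) = a ^ j * (a ^ r + b ^ r)"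
    by (simp add: j power_add diff_mult_distrib2 distrib_left mult.commute)
  then have "a ^ r + b ^ r dvd b ^ r * (a ^ j - b ^ j)"
    using assms(5) by (metis dvd_add_right_iff dvd_triv_right)
  moreover have "coprime (a ^ r) (b ^ r)" using assms by simp
  then have "coprime (a ^ r + b ^ r) (b ^ r)" unfolding coprime_iff_gcd_eq_1
    by (simp only: gcd_add1)
  ultimately have dvd: "a ^ r + b ^ r dvd a ^ j - b ^ j" using coprime_dvd_mult_right_iff by blast
  have "a ^ j < a ^ r" using j(2) assms by (intro power_strict_increasing) auto
  then have "a ^ j - b ^ j < a ^ r + b ^ r" by linarith
  then have "a ^ j - b ^ j = 0" using dvd by (meson nat_dvd_not_less not_gr_zero)
  then have "a ^ j = b ^ j" using le by simp
  then have "j = 0" using assms power_eq_iff_eq_base[of j a b] by force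
  then show ?thesis using j by simp
qed

text \<open>Even powers are squares, so the sum is 0, 1 or 2 modulo 4, while
  \<open>2 * t + 1\<close> is 3.\<close>

lemma sum_even_powers_mod_4:
  fixes a b r t :: nat
  assumes "even r" "odd t"
  shows "a ^ r + b ^ r \<noteq> 2 * t + 1"
proof
  assume eq: "a ^ r + b ^ r = 2 * t + 1"
  have sq: "x ^ r mod 4 \<in> {0, 1}" for x :: nat
  proof -
    obtain k where k: "r = 2 * k" using assms by blast
    have "x ^ r = x ^ k * x ^ k" by (simp add: k power_add mult_2)
    moreover have "y * y mod 4 \<in> {0, 1}" for y :: nat
    proof -
      have "y mod 4 \<in> {0, 1, 2, 3}" by auto
      moreover have "y * y mod 4 = (y mod 4) * (y mod 4) mod 4" by (simp add: mod_mult_eq)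
      ultimately show ?thesis by auto
    qed
    ultimately show ?thesis by simp
  qed
  have "(a ^ r + b ^ r) mod 4 = (a ^ r mod 4 + b ^ r mod 4) mod 4" by (simp add: mod_add_eq)
  then have "(a ^ r + b ^ r) mod 4 \<in> {0, 1, 2}" using sq[of a] sq[of b] by auto
  moreover obtain w where "t = 2 * w + 1" using assms by (elim oddE)
  then have "a ^ r + b ^ r = 4 * w + 3" using eq by simp
  then have "(a ^ r + b ^ r) mod 4 = 3" by presburger
  ultimately show False by simp
qed

section \<open>Even \<open>m > 2\<close> and odd \<open>n\<close>: no solutions\<close>

lemma large_even_exponent_impossible:
  fixes x y z m n :: nat
  assumes xy: "x > y" "y \<ge> 1" and z: "z \<ge> 1"
    and mn: "m > n" "n \<ge> 1" "even m" "odd n" "m > 2"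
    and eq: "totient (z * ((x ^ m - y ^ m) div (x + y))) = z * ((x ^ n + y ^ n) div (x + y))"
  shows False
proof -
  define U where "U = (x ^ m - y ^ m) div (x + y)"
  define V where "V = (x ^ n + y ^ n) div (x + y)"
  obtain d a b where ab: "d > 0" "coprime a b" "a > b" "b \<ge> 1" "x = d * a" "y = d * b"
    using coprime_scaling xy by blast
  define u where "u = (a ^ m - b ^ m) div (a + b)"
  define v where "v = (a ^ n + b ^ n) div (a + b)"
  define D where "D = d ^ (m - n)"
  define e where "e = d ^ (n - 1)"
  have u: "(a + b) * u = a ^ m - b ^ m" and v: "(a + b) * v = a ^ n + b ^ n"
    unfolding u_def v_def using mn ab by (simp_all add: sum_dvd_sum_powers_odd sum_dvd_diff_powers_even)
  have "a ^ n + b ^ n < a ^ m - b ^ m"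
    using ab mn by (intro sum_powers_less_diff_powers) auto
  then have "u > v" using u v by (metis mult_less_cancel1)
  have Vv: "V = e * v"
    unfolding e_def V_def v_def ab(5,6) using mn ab by (intro homogeneous_sum_quotient) auto
  have "U = d ^ (m - 1) * u"
    unfolding U_def u_def ab(5,6) using mn ab by (intro homogeneous_diff_quotient) auto
  moreover have "m - 1 = (n - 1) + (m - n)" using mn by simp
  ultimately have Uc: "U = e * (D * u)" by (simp only: e_def D_def power_add mult.assoc)
  have "D > 0" using ab by (simp add: D_def)
  have e: "e > 0" using ab by (simp add: e_def)
  have "U > 0" using Uc \<open>D > 0\<close> \<open>u > v\<close> e by simp
  have "odd v" unfolding v_def using ab mn odd_sum_powers_quotient by blast
  have eq': "totient (z * U) = z * V" and "z > 0" using eq z by (simp_all add: U_def V_def)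
  note tot = eq' \<open>z > 0\<close> \<open>U > 0\<close> Uc Vv \<open>odd v\<close>
  have "e * (D * u) \<le> e * (3 * v)"
    using totient_equation_bound[OF tot] Uc Vv by simp
  then have "D * u \<le> 3 * v" using e by simp
  also have "\<dots> < 3 * u" using \<open>u > v\<close> by simp
  finally have "D < 3" by simp
  have cases: "D * u = 2 * v \<or> (\<exists>p t. prime p \<and> p = 2 * t + 1 \<and> odd t \<and> t * (D * u) = p * v)"
    using tot
  proof (cases rule: totient_equation_cases)
    case equal
    then have "D * u = v" using Uc Vv e by simp
    moreover have "1 * u \<le> D * u" using \<open>D > 0\<close> by (intro mult_right_mono) auto
    ultimately show ?thesis using \<open>u > v\<close> by simp
  next
    case two_power
    then have "e * (D * u) = e * (2 * v)" unfolding Uc Vv by (simp only: ac_simps)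
    then show ?thesis using e by simp
  next
    case (two_prime_powers k l p t)
    then have "e * (t * (D * u)) = e * (p * v)"
      using Uc Vv by (simp only: mult.left_commute)
    then have "t * (D * u) = p * v" using e by simp
    then show ?thesis using two_prime_powers by blast
  qed
  \<comment> \<open>For \<open>D = 2\<close> the first alternative gives \<open>u = v\<close>, and
    the second equates an even number with the odd \<open>p * v\<close>.\<close>
  have "D \<noteq> 2"
  proof
    assume "D = 2"
    from cases show False
    proof
      assume "D * u = 2 * v"
      then show False using \<open>D = 2\<close> \<open>u > v\<close> by simp
    next
      assume "\<exists>p t. prime p \<and> p = 2 * t + 1 \<and> odd t \<and> t * (D * u) = p * v"
      then obtain p t where "p = 2 * t + 1" "t * (D * u) = p * v" by blast
      then have "even ((2 * t + 1) * v)" using \<open>D = 2\<close> by (metis dvd_mult dvd_triv_left)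
      then show False using \<open>odd v\<close> by simp
    qed
  qed
  then have "D = 1" using \<open>D > 0\<close> \<open>D < 3\<close> by simp
  obtain r where r: "m = 2 * r" using mn by blast
  have "r \<ge> 2" using r mn by simp
  have le: "b ^ r \<le> a ^ r" using ab by (simp add: power_mono)
  have fact: "(a ^ r - b ^ r) * (a ^ r + b ^ r) = a ^ m - b ^ m"
    by (simp add: r mult_2 power_add diff_mult_sum_nat)
  \<comment> \<open>The roles swap with the parity of \<open>r\<close> so that \<open>a + b\<close>
    always divides \<open>G\<close>; the whole of \<open>F\<close> then survives in
    \<open>u\<close>, and it is coprime to \<open>v\<close>.\<close>
  define F where "F = (if even r then a ^ r + b ^ r else a ^ r - b ^ r)"
  define G where "G = (if even r then a ^ r - b ^ r else a ^ r + b ^ r)"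
  have FG: "F * G = a ^ m - b ^ m" using fact by (simp add: F_def G_def mult.commute)
  have "a + b dvd G"
    using ab by (simp add: G_def sum_dvd_sum_powers_odd sum_dvd_diff_powers_even)
  then obtain w where w: "G = (a + b) * w" by blast
  have "(a + b) * u = (a + b) * (F * w)" using u FG w by (simp add: ac_simps)
  then have uF: "u = F * w" using ab by simp
  have "v dvd a ^ n + b ^ n" using v by (metis dvd_triv_right)
  then have "coprime v F"
    using coprime_sum_diff_powers[of a b r n v] coprime_sum_powers_odd_even[of a b r n v]
      ab mn \<open>odd v\<close> by (simp add: F_def)
  have "F > a + b" if "odd r"
  proof -
    have "r \<ge> 3" using that \<open>r \<ge> 2\<close> by (cases "r = 2") auto
    then have "a ^ 1 + b ^ 1 < a ^ r - b ^ r"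
      using ab by (intro sum_powers_less_diff_powers) auto
    then show ?thesis using that by (simp add: F_def)
  qed
  moreover have "F \<ge> a + b" if "even r"
  proof -
    have "a ^ 1 \<le> a ^ r" "b ^ 1 \<le> b ^ r"
      using ab \<open>r \<ge> 2\<close> by (intro power_increasing; simp)+
    then show ?thesis using that by (simp add: F_def)
  qed
  ultimately have F3: "F \<ge> 3" "odd r \<Longrightarrow> F > 3" using ab by force+
  from cases show False
  proof
    assume "D * u = 2 * v"
    then have "F dvd 2 * v" using uF \<open>D = 1\<close> by (metis dvd_triv_left mult_1)
    then have "F dvd 2" using \<open>coprime v F\<close> by (simp add: coprime_commute coprime_dvd_mult_left_iff)
    then have "F \<le> 2" by (intro dvd_imp_le) auto
    then show False using F3 by simp
  next
    assume "\<exists>p t. prime p \<and> p = 2 * t + 1 \<and> odd t \<and> t * (D * u) = p * v"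
    then obtain p t where p: "prime p" "p = 2 * t + 1" "odd t" and "t * (D * u) = p * v" by blast
    then have tu: "t * u = p * v" using \<open>D = 1\<close> by simp
    then have "F dvd p * v" using uF by (metis dvd_mult dvd_triv_left)
    then have "F dvd p" using \<open>coprime v F\<close> by (simp add: coprime_commute coprime_dvd_mult_left_iff)
    moreover have "F \<noteq> 1" using F3(1) by simp
    ultimately have "F = p" using p unfolding prime_nat_iff by blast
    then have "p * (t * w) = p * v" using tu uF by (simp add: ac_simps)
    then have "v = t * w" using prime_gt_0_nat[OF p(1)] by simp
    \<comment> \<open>Cancelling \<open>F = p\<close> turns the equation into a divisibility of
      \<open>a ^ n + b ^ n\<close> by \<open>G\<close>, with quotient exactly
      \<open>t\<close>.\<close>
    then have dv: "a ^ n + b ^ n = t * G" using v w by (metis mult.left_commute)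
    show False
    proof (cases "even r")
      case True
      then show False using sum_even_powers_mod_4[OF True p(3), of a b] \<open>F = p\<close> p by (simp add: F_def)
    next
      case False
      then have "n = r"
        using sum_powers_dvd_imp_exponent_eq[of a b n r] ab mn r dv by (simp add: G_def)
      then have "G = t * G" using dv False by (simp add: G_def)
      moreover have "G > 0" using False ab by (simp add: G_def)
      ultimately have "t = 1" by simp
      then show False using F3 False \<open>F = p\<close> p by simp
    qed
  qed
qed

section \<open>Even \<open>m\<close> and odd \<open>n\<close>: the exponents 2 and 1\<close>

lemma even_odd_solution:
  fixes x y z m n :: nat
  assumes xy: "x > y" "y \<ge> 1" and z: "z \<ge> 1" and mn: "m > n" "n \<ge> 1" "even m" "odd n"
    and eq: "totient (z * ((x ^ m - y ^ m) div (x + y))) = z * ((x ^ n + y ^ n) div (x + y))"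
  shows "m = 2 \<and> n = 1 \<and> (x = y + 1 \<and> z = 1 \<or> x = y + 2 \<and> (\<exists>s. z = 2 ^ s) \<or>
    x = y + 3 \<and> (\<exists>\<beta> s. \<beta> \<ge> 1 \<and> z = 2 ^ \<beta> * 3 ^ s))"
proof -
  have "m = 2" using large_even_exponent_impossible[OF assms(1-7) _ eq] mn by (cases "m = 2") auto
  then have "n = 1" using mn by simp
  have "x\<^sup>2 - y\<^sup>2 = (x - y) * (x + y)"
    by (simp add: power2_eq_square diff_mult_sum_nat)
  then have tz: "totient (z * (x - y)) = z"
    using eq xy by (simp add: \<open>m = 2\<close> \<open>n = 1\<close>)
  \<comment> \<open>The equation reads \<open>totient (z * (x - y)) = z\<close>, so the ratio lemma
    applies directly with \<open>c = x - y\<close> and \<open>v = 1\<close>.\<close>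
  have "z * (x - y) > 0" "totient (z * (x - y)) * (x - y) = z * (x - y) * 1" "odd (1::nat)"
    using tz z xy by auto
  then show ?thesis
  proof (cases rule: totient_ratio_odd_numerator)
    case one
    then have "x = y + 1" "z = 1" by auto
    then show ?thesis using \<open>m = 2\<close> \<open>n = 1\<close> by blast
  next
    case (two_power k)
    then have "z * 2 = 2 ^ (k - 1) * 2" by (simp add: power_eq_if)
    then have "x = y + 2" "z = 2 ^ (k - 1)" using two_power by auto
    then show ?thesis using \<open>m = 2\<close> \<open>n = 1\<close> by blast
  next
    case (two_prime_powers k l p t)
    have "t dvd 2 * t + 1" using two_prime_powers by (metis dvd_triv_left mult.right_neutral)
    then have "t = 1" by (metis dvd_add_right_iff dvd_triv_right nat_dvd_1_iff_1)
    then have "p = 3" "x - y = 3" using two_prime_powers by auto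
    then have "z * 3 = 2 ^ k * 3 ^ (l - 1) * 3" using two_prime_powers by (simp add: power_eq_if)
    then have "x = y + 3" "z = 2 ^ k * 3 ^ (l - 1)" using \<open>x - y = 3\<close> by auto
    then show ?thesis using \<open>m = 2\<close> \<open>n = 1\<close> \<open>k \<ge> 1\<close> by blast
  qed
qed

section \<open>The three solution sets\<close>

theorem theorem1p3:
  shows "({(x :: nat, y :: nat, z :: nat, m :: nat, n :: nat).
             x > y \<and> y \<ge> 1 \<and> z \<ge> 1 \<and> m > n \<and> n \<ge> 1 \<and> odd m \<and> odd n \<and>
             totient (z * ((x ^ m + y ^ m) div (x + y))) = z * ((x ^ n + y ^ n) div (x + y))}
          = {(2, 1, 3 ^ s * 2 ^ \<beta>, 3, 1) | (s :: nat) (\<beta> :: nat). \<beta> \<ge> 1})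
       \<and> ({(x :: nat, y :: nat, z :: nat, m :: nat, n :: nat).
             x > y \<and> y \<ge> 1 \<and> z \<ge> 1 \<and> m > n \<and> n \<ge> 1 \<and> even m \<and> odd n \<and>
             totient (z * ((x ^ m - y ^ m) div (x + y))) = z * ((x ^ n + y ^ n) div (x + y))}
          = {(a + 1, a, 1, 2, 1) | a :: nat. a \<ge> 1}
            \<union> {(a + 2, a, 2 ^ s, 2, 1) | (a :: nat) (s :: nat). a \<ge> 1}
            \<union> {(a + 3, a, 2 ^ \<beta> * 3 ^ s, 2, 1) | (a :: nat) (\<beta> :: nat) (s :: nat). a \<ge> 1 \<and> \<beta> \<ge> 1})
       \<and> ({(x :: nat, y :: nat, z :: nat, m :: nat, n :: nat).
             x > y \<and> y \<ge> 1 \<and> z \<ge> 1 \<and> m > n \<and> n \<ge> 1 \<and> odd m \<and> even n \<and>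
             multiplicity 2 x \<noteq> multiplicity 2 y \<and>
             totient (z * ((x ^ m + y ^ m) div (x + y))) = z * ((x ^ n - y ^ n) div (x + y))}
          = {(2, 1, p ^ s * 2 ^ \<beta>, q, q - 1) | (p :: nat) (q :: nat) (s :: nat) (\<beta> :: nat).
               \<beta> \<ge> 1 \<and> prime q \<and> prime p \<and> 3 * p = 2 ^ q + 1})"
proof (intro conjI, goal_cases)
  case 1
  show ?case
  proof (intro equalityI subsetI, goal_cases)
    case (1 w)
    then obtain x y z m n where w: "w = (x, y, z, m, n)" by (cases w) auto
    with 1 show ?case using odd_odd_solution[of y x z n m] by blast
  next
    case (2 w)
    then obtain s \<beta> where w: "w = (2, 1, 3 ^ s * 2 ^ \<beta>, 3, 1)" "\<beta> \<ge> 1" by blast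
    then show ?case using totient_three_two_powers[of \<beta> s] by simp
  qed
next
  case 2
  have quot: "((a + k)\<^sup>2 - a\<^sup>2) div (a + k + a) = k" if "a \<ge> 1" for a k :: nat
  proof -
    have "(a + k)\<^sup>2 - a\<^sup>2 = k * (a + k + a)"
      by (simp add: power2_eq_square algebra_simps)
    then show ?thesis using that by simp
  qed
  show ?case
  proof (intro equalityI subsetI, goal_cases)
    case (1 w)
    then obtain x y z m n where w: "w = (x, y, z, m, n)" by (cases w) auto
    with 1 show ?case using even_odd_solution[of y x z n m] by blast
  next
    case (2 w)
    then consider (one) a where "w = (a + 1, a, 1, 2, 1)" "a \<ge> 1"
      | (two) a s where "w = (a + 2, a, 2 ^ s, 2, 1)" "a \<ge> 1"
      | (three) a \<beta> s where "w = (a + 3, a, 2 ^ \<beta> * 3 ^ s, 2, 1)" "a \<ge> 1" "\<beta> \<ge> 1"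
      by blast
    then show ?case
    proof cases
      case one
      then show ?thesis using quot[of a 1] by simp
    next
      case two
      then show ?thesis
        using quot[of a 2] totient_prime_power_Suc[OF two_is_prime_nat, of s] by (simp add: mult.commute)
    next
      case three
      then show ?thesis
        using quot[of a 3] totient_three_two_powers[of \<beta> s] by (simp add: mult.commute)
    qed
  qed
next
  case 3
  show ?case
  proof (intro equalityI subsetI, goal_cases)
    case (1 w)
    then obtain x y z m n where w: "w = (x, y, z, m, n)" by (cases w) auto
    with 1 show ?case using odd_even_solution[of y x z n m] by blast
  next
    case (2 w)
    then obtain p q s \<beta> where w: "w = (2, 1, p ^ s * 2 ^ \<beta>, q, q - 1)"
      and "\<beta> \<ge> 1" "prime q" "prime p" and pq: "3 * p = 2 ^ q + 1" by blast
    \<comment> \<open>\<open>q = 2\<close> would give \<open>3 * p = 5\<close>.\<close>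
    have "q \<noteq> 2" using pq by (auto, presburger)
    then have "odd q" "q > 2" using \<open>prime q\<close> prime_odd_nat prime_ge_2_nat[of q] by force+
    have "(2::nat) ^ q = 2 * 2 ^ (q - 1)" using \<open>q > 2\<close> by (simp add: power_eq_if)
    \<comment> \<open>This \<open>t\<close> is both the quotient on the right of the equation and
      \<open>(p - 1) / 2\<close>, because
      \<open>2 ^ q + 1 = 2 * (2 ^ (q - 1) - 1) + 3\<close>.\<close>
    define t where "t = ((2::nat) ^ (q - 1) - 1) div 3"
    have "3 dvd (2::nat) ^ (q - 1) - 1"
      using sum_dvd_diff_powers_even[of "q - 1" 1 2] \<open>odd q\<close> by simp
    then have "3 * t = 2 ^ (q - 1) - 1" by (simp add: t_def)
    moreover have "(2::nat) ^ (q - 1) \<ge> 1" by simp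
    ultimately have "p = 2 * t + 1"
      using pq \<open>(2::nat) ^ q = 2 * 2 ^ (q - 1)\<close> by linarith
    moreover have "(2 ^ q + 1) div 3 = p" using pq by (metis nonzero_mult_div_cancel_left zero_neq_numeral)
    ultimately have "totient (p ^ s * 2 ^ \<beta> * ((2 ^ q + 1) div 3)) = p ^ s * 2 ^ \<beta> * ((2 ^ (q - 1) - 1) div 3)"
      using totient_two_prime_powers \<open>prime p\<close> \<open>\<beta> \<ge> 1\<close> t_def by metis
    moreover have "p ^ s * 2 ^ \<beta> \<ge> 1" using \<open>prime p\<close> prime_gt_0_nat[of p] by simp
    ultimately show ?case using w \<open>odd q\<close> \<open>q > 2\<close> by simp
  qed
qed

end
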